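(* Consider a polymatroid game: for each $i\in N$ let $f_i:2^E\to\mathbb{Z}$ be an integral polymatroid rank function, let $X_i=\{x_i\in\mathbb{Z}^m: x_i(U)\le f_i(U)\text{ for all }U\subseteq E,\ x_i(E)=f_i(E)\}$, $g_i(x_i)=x_i$, and $\pi_i(u,x_i)=\sum_{j\in E}\pi_{ij}(u)x_{ij}$ with player-specific functions $\pi_{ij}:\mathbb{Z}^m\to\mathbb{R}$. Then every $u\in\mathbb{Z}^m$ for which the problem $\min\{\sum_{i\in N}\pi_i(u,x_i):\ell(x)\le u,\ x\in X\}$ admits a finite optimal solution is weakly enforceable with market clearing prices for $G^{\min}(u)$. If $u\in\mathbb{Z}^m$ is minimal for $X$, then $u$ is enforceable for $G^{\min}(u)$.
   Context: Setting. $E=\{1,\dots,m\}$, $N=\{1,\dots,n\}$ are finite nonempty sets, $X=\prod_{i\in N}X_i$, $\ell(x)=\sum_{i\in N}x_i$, and $x_i(U)=\sum_{j\in U}x_{ij}$ for $U\subseteq E$. In $G^{\min}(u)$ player $i$ chooses $x_i\in X_i$ with cost $\pi_i(u,x_i)$. An integral polymatroid rank function is a function $f:2^E\to\mathbb{Z}$ that is submodular ($f(U)+f(V)\ge f(U\cup V)+f(U\cap V)$), monotone ($U\subseteq V\Rightarrow f(U)\le f(V)$) and normalized ($f(\emptyset)=0$). Enforceability. $u$ is enforceable if there is $(x^*,\lambda)\in X\times\mathbb{R}^m_+$ with $\ell(x^* )=u$ and (b) $x_i^*\in\arg\min_{x_i\in X_i}\{\pi_i(u,x_i)+\lambda^\intercal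 x_i\}$ for all $i\in N$. It is weakly enforceable with market clearing prices if there is $(x^*,\lambda)\in X\times\mathbb{R}^m_+$ such that (b) holds, $\ell(x^* )\le u$, and $\ell_j(x^* )<u_j\Rightarrow\lambda_j=0$ for all $j\in E$. $u$ is minimal for $X$ if there are strictly increasing $h_j:\mathbb{R}\to\mathbb{R}$ ($j\in E$) such that $u\in\arg\min_{u'\in\mathbb{R}^m}\{\sum_{j\in E}h_j(u'_j):\exists x\in X\text{ with }\ell(x)\le u'\}$. *)

theory Defs
  imports "HOL-Analysis.Analysis"
begin

text \<open>
  The resource set E and the player set N are the universes of two finite types \<open>'e\<close> and \<open>'i\<close>,
  which are automatically nonempty. The vector order \<open>\<le>\<close> on \<open>real ^ 'e\<close> is componentwise.
\<close>

definition int_vecs :: "(real ^ 'e) set" where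
  "int_vecs = {x. \<forall>j. x $ j \<in> \<int>}"

definition load_on :: "real ^ 'e \<Rightarrow> 'e set \<Rightarrow> real" where
  "load_on x U = (\<Sum>j\<in>U. x $ j)"

definition integral_polymatroid_rank :: "('e set \<Rightarrow> int) \<Rightarrow> bool" where
  "integral_polymatroid_rank f \<longleftrightarrow>
     (\<forall>U V. f U + f V \<ge> f (U \<union> V) + f (U \<inter> V)) \<and>
     (\<forall>U V. U \<subseteq> V \<longrightarrow> f U \<le> f V) \<and>
     f {} = 0"

definition integral_base_set :: "('e::finite set \<Rightarrow> int) \<Rightarrow> (real ^ 'e) set" where
  "integral_base_set f =
     {x \<in> int_vecs. (\<forall>U. load_on x U \<le> of_int (f U)) \<and> load_on x UNIV = of_int (f UNIV)}"

definition profiles :: "('i \<Rightarrow> (real ^ 'e) set) \<Rightarrow> ('i \<Rightarrow> real ^ 'e) set" where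
  "profiles X = Pi UNIV X"

definition load :: "('i::finite \<Rightarrow> real ^ 'e) \<Rightarrow> real ^ 'e" where
  "load x = (\<Sum>i\<in>UNIV. x i)"

text \<open>
  In the following, \<open>c i u y\<close> is the cost of player \<open>i\<close> for strategy \<open>y\<close> in the game
  \<open>G\<^sup>m\<^sup>i\<^sup>n(u)\<close>, and \<open>p\<close> is the price vector (the multiplier written lambda in the literature).
\<close>

definition priced_best_response ::
  "('i \<Rightarrow> (real ^ 'e) set) \<Rightarrow> ('i \<Rightarrow> real ^ 'e \<Rightarrow> real ^ 'e \<Rightarrow> real) \<Rightarrow>
     real ^ 'e \<Rightarrow> real ^ 'e \<Rightarrow> ('i \<Rightarrow> real ^ 'e) \<Rightarrow> bool" where
  "priced_best_response X c u p x \<longleftrightarrow>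
     (\<forall>i. is_arg_min (\<lambda>y. c i u y + p \<bullet> y) (\<lambda>y. y \<in> X i) (x i))"

definition enforceable ::
  "('i::finite \<Rightarrow> (real ^ 'e) set) \<Rightarrow> ('i \<Rightarrow> real ^ 'e \<Rightarrow> real ^ 'e \<Rightarrow> real) \<Rightarrow>
     real ^ 'e \<Rightarrow> bool" where
  "enforceable X c u \<longleftrightarrow>
     (\<exists>x \<in> profiles X. \<exists>p \<ge> 0. load x = u \<and> priced_best_response X c u p x)"

definition weakly_enforceable_market_clearing ::
  "('i::finite \<Rightarrow> (real ^ 'e) set) \<Rightarrow> ('i \<Rightarrow> real ^ 'e \<Rightarrow> real ^ 'e \<Rightarrow> real) \<Rightarrow>
     real ^ 'e \<Rightarrow> bool" where
  "weakly_enforceable_market_clearing X c u \<longleftrightarrow>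
     (\<exists>x \<in> profiles X. \<exists>p \<ge> 0.
        priced_best_response X c u p x \<and> load x \<le> u \<and>
        (\<forall>j. load x $ j < u $ j \<longrightarrow> p $ j = 0))"

definition minimal_for ::
  "('i::finite \<Rightarrow> (real ^ 'e) set) \<Rightarrow> real ^ 'e \<Rightarrow> bool" where
  "minimal_for X u \<longleftrightarrow>
     (\<exists>h :: 'e \<Rightarrow> real \<Rightarrow> real. (\<forall>j. strict_mono (h j)) \<and>
        is_arg_min (\<lambda>u'. \<Sum>j\<in>UNIV. h j (u' $ j)) (\<lambda>u'. \<exists>x \<in> profiles X. load x \<le> u') u)"

definition master_problem_solvable ::
  "('i::finite \<Rightarrow> (real ^ 'e) set) \<Rightarrow> ('i \<Rightarrow> real ^ 'e \<Rightarrow> real ^ 'e \<Rightarrow> real) \<Rightarrow>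
     real ^ 'e \<Rightarrow> bool" where
  "master_problem_solvable X c u \<longleftrightarrow>
     (\<exists>x. is_arg_min (\<lambda>x. \<Sum>i\<in>UNIV. c i u (x i)) (\<lambda>x. load x \<le> u \<and> x \<in> profiles X) x)"

text \<open>
  The coefficients \<open>w i j\<close> matter only at integral \<open>u\<close>; arbitrary functions on the integral
  vectors are represented by arbitrary extensions to \<open>real ^ 'e\<close>.
\<close>

definition linear_cost ::
  "('i \<Rightarrow> 'e::finite \<Rightarrow> real ^ 'e \<Rightarrow> real) \<Rightarrow> 'i \<Rightarrow> real ^ 'e \<Rightarrow> real ^ 'e \<Rightarrow> real" where
  "linear_cost w i u y = (\<Sum>j\<in>UNIV. w i j u * y $ j)"

end

theory Submission
  imports Defs
begin

text \<open>
  Relax the master problem to real points of the base polytopes. Every extreme point of the relaxed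
  feasible set is integral: the fractional entries of a point form the edges of a bipartite graph
  joining the atoms of the players' lattices of tight sets to the resources, and if there are any,
  then counting dimensions yields a direction in which the point can be moved both ways. An integral
  optimum is therefore also optimal for the relaxation, so linear programming duality provides
  prices under which it minimizes the total priced cost, hence each player's priced cost, with
  complementary slackness. If \<open>u\<close> is minimal, every feasible profile has load exactly \<open>u\<close>.
\<close>

section \<open>Balanced weights on a bipartite graph\<close>

text \<open>The nonempty fibres of \<open>L\<close> partition \<open>S\<close>, and each has at
  least two elements.\<close>

lemma two_card_image_le:
  assumes fin: "finite S"
    and rep: "\<And>e. e \<in> S \<Longrightarrow> \<exists>e' \<in> S. e' \<noteq> e \<and> L e' = L e"
  shows "2 * card (L ` S) \<le> card S"
proof -
  have "card {e \<in> S. L e = a} \<ge> 2" if "a \<in> L ` S" for a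
  proof -
    from that obtain e where e: "e \<in> S" "L e = a" by auto
    from rep[OF e(1)] obtain e' where e': "e' \<in> S" "e' \<noteq> e" "L e' = L e" by auto
    have "card {e, e'} \<le> card {e \<in> S. L e = a}"
      by (rule card_mono) (use fin e e' in auto)
    then show ?thesis using e' by simp
  qed
  then have "(\<Sum>a\<in>L ` S. 2) \<le> (\<Sum>a\<in>L ` S. card {e \<in> S. L e = a})"
    by (intro sum_mono) auto
  also have "\<dots> = card S"
    using sum.image_gen[OF fin, of "\<lambda>_. 1 :: nat" L] by simp
  finally show ?thesis by simp
qed

text \<open>Only the fibre over \<open>z\<close> may be a singleton. Dropping it removes one image
  point and at least one element of \<open>S\<close>, hence the extra one. Later \<open>z\<close> is
  the merged right vertex \<open>None\<close>.\<close>

lemma two_card_image_le_except: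
  assumes fin: "finite S"
    and rep: "\<And>e. e \<in> S \<Longrightarrow> R e \<noteq> z \<Longrightarrow> \<exists>e' \<in> S. e' \<noteq> e \<and> R e' = R e"
  shows "2 * card (R ` S) \<le> card S + 1"
proof (cases "z \<in> R ` S")
  case False
  then have "2 * card (R ` S) \<le> card S"
    by (intro two_card_image_le fin) (use rep in blast)
  then show ?thesis by simp
next
  case True
  then obtain e where e: "e \<in> S" "R e = z" by auto
  let ?S = "{e \<in> S. R e \<noteq> z}"
  have "2 * card (R ` ?S) \<le> card ?S"
    using rep by (intro two_card_image_le) (use fin in auto, metis)
  moreover have "card ?S < card S"
    by (rule psubset_card_mono) (use fin e in auto)
  moreover have "R ` S \<subseteq> insert z (R ` ?S)" by auto
  then have "card (R ` S) \<le> card (R ` ?S) + 1"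
    using card_mono[of "insert z (R ` ?S)" "R ` S"] card_insert_le_m1[of "card (R ` ?S) + 1" "R ` ?S" z] fin
    by (simp add: card_insert_if split: if_splits)
  ultimately show ?thesis by linarith
qed

text \<open>
  Regard \<open>S\<close> as the edge set of a bipartite graph in which all right vertices outside \<open>T\<close>
  are merged into one vertex. All other vertices have degree at least two, so there are at
  least as many edges as vertices, while the values of the boundary map have total sum zero.
\<close>
lemma balanced_edge_weights_exist:
  fixes L :: "'k::finite \<Rightarrow> 'a::finite" and R :: "'k \<Rightarrow> 'b::finite"
  assumes ne: "S \<noteq> {}"
    and repL: "\<And>e. e \<in> S \<Longrightarrow> \<exists>e' \<in> S. e' \<noteq> e \<and> L e' = L e"
    and repR: "\<And>e. e \<in> S \<Longrightarrow> R e \<in> T \<Longrightarrow> \<exists>e' \<in> S. e' \<noteq> e \<and> R e' = R e"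
  obtains d :: "'k \<Rightarrow> real" where "d \<noteq> (\<lambda>_. 0)" "\<And>e. e \<notin> S \<Longrightarrow> d e = 0"
    "\<And>a. (\<Sum>e | L e = a. d e) = 0" "\<And>b. b \<in> T \<Longrightarrow> (\<Sum>e | R e = b. d e) = 0"
proof -
  define R' where "R' e = (if R e \<in> T then Some (R e) else None)" for e
  define N where "N = Inl ` L ` S \<union> Inr ` R' ` S"
  define V where "V = {x :: real ^ 'k. \<forall>e. e \<notin> S \<longrightarrow> x $ e = 0}"
  define VN where "VN = {x :: real ^ ('a + 'b option). \<forall>v. v \<notin> N \<longrightarrow> x $ v = 0}"
  define W where "W = {x \<in> VN. (\<Sum>v\<in>UNIV. x $ v) = 0}"
  \<comment> \<open>Incidence map: opposite signs on the two sides make the contributions of each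
    edge cancel in the coordinate sum.\<close>
  define \<phi> :: "real ^ 'k \<Rightarrow> real ^ ('a + 'b option)" where
    "\<phi> x = (\<chi> v. case v of Inl a \<Rightarrow> (\<Sum>e | L e = a. x $ e) | Inr b \<Rightarrow> - (\<Sum>e | R' e = b. x $ e))" for x
  have lin: "linear \<phi>"
    by (rule linearI) (auto simp: \<phi>_def vec_eq_iff sum.distrib sum_distrib_left split: sum.splits)
  have subV: "subspace V" unfolding V_def subspace_def by auto
  have subVN: "subspace VN" unfolding VN_def subspace_def by auto
  have subW: "subspace W" using subVN unfolding W_def subspace_def
    by (auto simp: sum.distrib sum_distrib_left[symmetric])
  have dimV: "dim V = card S"
    unfolding V_def using dim_substandard_cart[of S, where 'a = real] by (simp add: dim_vec_eq)
  have dimVN: "dim VN = card N"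
    unfolding VN_def using dim_substandard_cart[of N, where 'a = real] by (simp add: dim_vec_eq)
  \<comment> \<open>The zero-sum condition saves one dimension, since a unit vector at an end of an
    edge violates it. So \<open>card N \<le> card S\<close> will suffice.\<close>
  have "W \<subset> VN"
  proof -
    obtain e where e: "e \<in> S" using ne by auto
    have "axis (Inl (L e)) 1 \<in> VN - W"
      using e by (auto simp: VN_def W_def axis_def N_def)
    then show ?thesis by (auto simp: W_def)
  qed
  then have "dim W < dim VN"
    by (intro dim_psubset) (simp add: span_eq_iff[THEN iffD2] subW subVN)
  moreover have "card N \<le> card S"
  proof -
    have "card N = card (L ` S) + card (R' ` S)"
      unfolding N_def by (subst card_Un_disjoint) (auto simp: card_image)
    moreover have "2 * card (L ` S) \<le> card S"
      by (rule two_card_image_le) (use repL in auto)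
    \<comment> \<open>The merged vertex may have degree one. Both bounds together give
      \<open>2 * card N \<le> 2 * card S + 1\<close>, which is enough over the naturals.\<close>
    moreover have "2 * card (R' ` S) \<le> card S + 1"
    proof (rule two_card_image_le_except[where z = None])
      show "\<exists>e'\<in>S. e' \<noteq> e \<and> R' e' = R' e" if "e \<in> S" "R' e \<noteq> None" for e
      proof -
        have T: "R e \<in> T" using that(2) by (simp add: R'_def split: if_splits)
        from repR[OF that(1) T] obtain e' where e': "e' \<in> S" "e' \<noteq> e" "R e' = R e" by blast
        moreover have "R' e' = R' e" by (simp only: R'_def e'(3))
        ultimately show ?thesis by blast
      qed
    qed simp
    ultimately show ?thesis by linarith
  qed
  ultimately have less: "dim W < dim V" using dimV dimVN by simp
  have "\<phi> ` V \<subseteq> W"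
  proof
    fix y assume "y \<in> \<phi> ` V"
    then obtain x where x: "x \<in> V" "y = \<phi> x" by auto
    have "\<phi> x $ v = 0" if "v \<notin> N" for v
    proof (cases v)
      case (Inl a)
      then show ?thesis using that x(1)
        by (auto simp: \<phi>_def N_def V_def intro!: sum.neutral)
    next
      case (Inr b)
      then show ?thesis using that x(1)
        by (auto simp: \<phi>_def N_def V_def intro!: sum.neutral)
    qed
    moreover have "(\<Sum>v\<in>UNIV. \<phi> x $ v) = 0"
    proof -
      have "(\<Sum>v\<in>UNIV. \<phi> x $ v) = (\<Sum>a\<in>UNIV. \<phi> x $ Inl a) + (\<Sum>b\<in>UNIV. \<phi> x $ Inr b)"
        by (simp add: UNIV_Plus_UNIV[symmetric] sum.Plus del: UNIV_Plus_UNIV)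
      also have "(\<Sum>a\<in>UNIV. \<phi> x $ Inl a) = (\<Sum>e\<in>UNIV. x $ e)"
        using sum.group[of UNIV UNIV L "\<lambda>e. x $ e"] by (simp add: \<phi>_def)
      also have "(\<Sum>b\<in>UNIV. \<phi> x $ Inr b) = - (\<Sum>e\<in>UNIV. x $ e)"
        using sum.group[of UNIV UNIV R' "\<lambda>e. x $ e"] by (simp add: \<phi>_def sum_negf)
      finally show ?thesis by simp
    qed
    ultimately show "y \<in> W" using x by (simp add: W_def VN_def)
  qed
  then have "dim (\<phi> ` V) < dim V"
    using dim_subset[of "\<phi> ` V" W] less by linarith
  then have "\<not> inj_on \<phi> (span V)"
    using dim_image_eq[OF lin, of V] by auto
  then obtain x x' where xx: "x \<in> V" "x' \<in> V" "x \<noteq> x'" "\<phi> x = \<phi> x'"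
    using subV by (auto simp: inj_on_def span_eq_iff[THEN iffD2])
  define d where "d = x - x'"
  have d: "d \<in> V" "d \<noteq> 0" "\<phi> d = 0"
    using xx subV lin by (auto simp: d_def subspace_diff linear_diff)
  show thesis
  proof (rule that[of "\<lambda>e. d $ e"])
    show "($) d \<noteq> (\<lambda>_. 0)" using d(2) by (auto simp: vec_eq_iff fun_eq_iff)
    show "d $ e = 0" if "e \<notin> S" for e using d(1) that by (simp add: V_def)
    show "(\<Sum>e | L e = a. d $ e) = 0" for a
      using arg_cong[OF d(3), of "\<lambda>v. v $ Inl a"] by (simp add: \<phi>_def)
    show "(\<Sum>e | R e = b. d $ e) = 0" if "b \<in> T" for b
    proof -
      have "{e. R' e = Some b} = {e. R e = b}" using that by (auto simp: R'_def)
      then show ?thesis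
        using arg_cong[OF d(3), of "\<lambda>v. v $ Inr (Some b)"] by (simp add: \<phi>_def)
    qed
  qed
qed

section \<open>Base polytopes\<close>

text \<open>The bound is an arbitrary real set function, so that sums and nonnegative multiples of
  bases stay within the same notion; the cone of the pricing argument relies on this.\<close>

definition base_polytope :: "('e::finite set \<Rightarrow> real) \<Rightarrow> (real ^ 'e) set" where
  "base_polytope g = {x. (\<forall>U. load_on x U \<le> g U) \<and> load_on x UNIV = g UNIV}"

lemma integral_base_set_eq:
  "integral_base_set f = int_vecs \<inter> base_polytope (\<lambda>U. of_int (f U))"
  by (auto simp: integral_base_set_def base_polytope_def)

lemma load_on_add: "load_on (x + y) U = load_on x U + load_on y U"
  by (simp add: load_on_def sum.distrib)

lemma load_on_scaleR: "load_on (r *\<^sub>R x) U = r * load_on x U"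
  by (simp add: load_on_def sum_distrib_left)

lemma base_polytope_add:
  "x \<in> base_polytope g \<Longrightarrow> y \<in> base_polytope h \<Longrightarrow> x + y \<in> base_polytope (\<lambda>U. g U + h U)"
  by (auto simp: base_polytope_def load_on_add add_mono)

lemma base_polytope_scaleR:
  "x \<in> base_polytope g \<Longrightarrow> 0 \<le> r \<Longrightarrow> r *\<^sub>R x \<in> base_polytope (\<lambda>U. r * g U)"
  by (auto simp: base_polytope_def load_on_scaleR mult_left_mono)

text \<open>The lower bound is the total minus the largest load allowed on the complement of
  \<open>j\<close>. These bounds yield finiteness and boundedness, and for \<open>g = 0\<close> they
  force \<open>x = 0\<close>.\<close>

lemma base_polytope_component_bounds:
  fixes x :: "real ^ 'e::finite"
  assumes "x \<in> base_polytope g"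
  shows "g UNIV - g (UNIV - {j}) \<le> x $ j" "x $ j \<le> g {j}"
proof -
  have "load_on x UNIV = load_on x (UNIV - {j}) + x $ j"
    unfolding load_on_def by (subst sum.remove[of _ j]) auto
  moreover have "load_on x (UNIV - {j}) \<le> g (UNIV - {j})" "load_on x UNIV = g UNIV"
    using assms by (auto simp: base_polytope_def)
  ultimately show "g UNIV - g (UNIV - {j}) \<le> x $ j" by linarith
  have "load_on x {j} \<le> g {j}" using assms unfolding base_polytope_def by blast
  then show "x $ j \<le> g {j}" by (simp add: load_on_def)
qed

lemma finite_vec_box:
  assumes "\<And>j. finite (A j)"
  shows "finite {x :: 'a ^ 'n::finite. \<forall>j. x $ j \<in> A j}"
proof (rule finite_subset)
  show "{x. \<forall>j. x $ j \<in> A j} \<subseteq> vec_lambda ` (PiE UNIV A)"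
  proof
    fix x :: "'a ^ 'n" assume "x \<in> {x. \<forall>j. x $ j \<in> A j}"
    then have "vec_nth x \<in> PiE UNIV A" "x = vec_lambda (vec_nth x)" by (auto simp: PiE_def vec_eq_iff)
    then show "x \<in> vec_lambda ` (PiE UNIV A)" by blast
  qed
qed (use assms in \<open>simp add: finite_PiE\<close>)

lemma finite_integral_base_set: "finite (integral_base_set f)"
proof (rule finite_subset)
  let ?A = "\<lambda>j. {k \<in> \<int>. real_of_int (f UNIV) - of_int (f (UNIV - {j})) \<le> k \<and> k \<le> of_int (f {j})}"
  show "integral_base_set f \<subseteq> {x. \<forall>j. x $ j \<in> ?A j}"
    by (auto simp: integral_base_set_eq int_vecs_def dest: base_polytope_component_bounds)
  show "finite {x :: real ^ 'a. \<forall>j. x $ j \<in> ?A j}"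
    by (rule finite_vec_box) (rule finite_int_segment)
qed

text \<open>If all other summands were integers, so would be the remaining one. This supplies a
  second edge at every vertex with integral total.\<close>

lemma exists_other_non_integer:
  fixes g :: "'a \<Rightarrow> real"
  assumes "finite A" "sum g A \<in> \<int>" "a \<in> A" "g a \<notin> \<int>"
  shows "\<exists>b\<in>A. b \<noteq> a \<and> g b \<notin> \<int>"
proof (rule ccontr)
  assume "\<not> ?thesis"
  then have "sum g (A - {a}) \<in> \<int>" by (intro Ints_sum) auto
  moreover have "g a = sum g A - sum g (A - {a})"
    using assms by (simp add: sum.remove)
  ultimately show False using assms by auto
qed

text \<open>
  \<open>D j\<close> is the smallest tight set containing \<open>j\<close>. Its fibres are the atoms of the lattice of
  tight sets, each of them a difference of two tight sets.
\<close>
lemma tight_set_atoms: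
  fixes x :: "real ^ 'e::finite"
  assumes rank: "integral_polymatroid_rank f"
    and x: "x \<in> base_polytope (\<lambda>U. of_int (f U))"
  obtains D :: "'e \<Rightarrow> 'e set" where
    "\<And>A. load_on x {j. D j = A} \<in> \<int>"
    "\<And>U d. load_on x U = of_int (f U) \<Longrightarrow> (\<And>A. load_on d {j. D j = A} = 0) \<Longrightarrow> load_on d U = 0"
proof -
  define TT where "TT = {U. load_on x U = of_int (f U)}"
  \<comment> \<open>Uncrossing: loads are modular, so submodularity forces equality in both upper
    bounds.\<close>
  have lattice: "U \<union> V \<in> TT \<and> U \<inter> V \<in> TT" if UV: "U \<in> TT" "V \<in> TT" for U V
  proof -
    have "load_on x (U \<union> V) + load_on x (U \<inter> V) = load_on x U + load_on x V"
      unfolding load_on_def by (rule sum.union_inter) auto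
    moreover have "load_on x (U \<union> V) \<le> of_int (f (U \<union> V))" "load_on x (U \<inter> V) \<le> of_int (f (U \<inter> V))"
      using x unfolding base_polytope_def by blast+
    moreover have "f (U \<union> V) + f (U \<inter> V) \<le> f U + f V"
      using rank unfolding integral_polymatroid_rank_def by blast
    then have "real_of_int (f (U \<union> V)) + of_int (f (U \<inter> V)) \<le> of_int (f U) + of_int (f V)"
      by linarith
    ultimately show ?thesis using UV unfolding TT_def by auto
  qed
  have empty: "{} \<in> TT"
    using rank by (simp add: TT_def load_on_def integral_polymatroid_rank_def)
  have univ: "UNIV \<in> TT" using x by (simp add: TT_def base_polytope_def)
  define D where "D j = \<Inter>{U \<in> TT. j \<in> U}" for j
  have D_mem: "j \<in> D j" for j by (auto simp: D_def)
  have D_tight: "D j \<in> TT" for j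
  proof -
    have "D j \<in> {U \<in> TT. j \<in> U}"
      unfolding D_def by (rule finite_Inf_in) (use univ lattice in auto)
    then show ?thesis by simp
  qed
  have D_least: "D j \<subseteq> U" if "U \<in> TT" "j \<in> U" for j U
    using that by (auto simp: D_def)
  show thesis
  proof
    show "load_on x {j. D j = A} \<in> \<int>" for A
    proof (cases "\<exists>j. D j = A")
      case False
      then show ?thesis by (simp add: load_on_def)
    next
      case True
      then obtain j where j: "D j = A" by auto
      \<comment> \<open>\<open>B\<close> unites the smaller minimal tight sets inside
        \<open>A\<close>. As a finite union it is tight, so the fibre \<open>A - B\<close> has the
        integral load \<open>f A - f B\<close>.\<close>
      define B where "B = \<Union>(insert {} (D ` {k \<in> A. D k \<noteq> A}))"
      have Un_tight: "\<Union>F \<in> TT" if "F \<subseteq> TT" for F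
        using finite_subset[OF subset_UNIV finite, of F] that
        by (induction F rule: finite_induct) (use empty lattice in auto)
      have B: "B \<in> TT" unfolding B_def by (rule Un_tight) (use empty D_tight in auto)
      have BA: "B \<subseteq> A"
        using D_least[OF D_tight[of j]] j by (auto simp: B_def)
      have atom: "{j. D j = A} = A - B"
      proof (intro equalityI subsetI)
        fix k assume "k \<in> {j. D j = A}"
        then have k: "D k = A" by simp
        \<comment> \<open>If \<open>k\<close> were in \<open>D l\<close>, minimality in both
          directions would give \<open>D l = D k = A\<close>.\<close>
        have "k \<notin> D l" if "l \<in> A" "D l \<noteq> A" for l
          using D_least[OF D_tight[of l], of k] D_least[OF D_tight[of k], of l] that k by auto
        then show "k \<in> A - B" using D_mem[of k] k by (auto simp: B_def)
      next
        fix k assume "k \<in> A - B"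
        then show "k \<in> {j. D j = A}" using D_mem[of k] by (auto simp: B_def)
      qed
      have "load_on x {j. D j = A} = load_on x A - load_on x B"
        unfolding atom load_on_def using BA by (simp add: sum_diff)
      also have "\<dots> = of_int (f A - f B)"
        using B D_tight[of j] j by (simp add: TT_def)
      finally show ?thesis by (metis Ints_of_int)
    qed
  next
    fix U d
    assume U: "load_on x U = of_int (f U)" and d: "\<And>A. load_on d {j. D j = A} = 0"
    have "load_on d U = (\<Sum>A\<in>D ` U. \<Sum>j\<in>{j \<in> U. D j = A}. d $ j)"
      unfolding load_on_def by (rule sum.image_gen) simp
    \<comment> \<open>A tight set contains every fibre that it meets, since it contains
      \<open>D j\<close> for each of its points \<open>j\<close>.\<close>
    also have "\<dots> = (\<Sum>A\<in>D ` U. load_on d {j. D j = A})"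
    proof (rule sum.cong)
      fix A assume "A \<in> D ` U"
      then have "A \<subseteq> U" using D_least U by (auto simp: TT_def)
      then have "{j \<in> U. D j = A} = {j. D j = A}" using D_mem by blast
      then show "(\<Sum>j\<in>{j \<in> U. D j = A}. d $ j) = load_on d {j. D j = A}"
        by (simp add: load_on_def)
    qed simp
    finally show "load_on d U = 0" using d by simp
  qed
qed

section \<open>Integrality of the relaxed master problem\<close>

text \<open>Profiles are encoded as vectors of vectors to make inner products, compactness and
  extreme points of a Euclidean space available.\<close>

definition relaxation ::
  "('i::finite \<Rightarrow> 'e::finite set \<Rightarrow> int) \<Rightarrow> real ^ 'e \<Rightarrow> (real ^ 'e ^ 'i) set" where
  "relaxation f u =
     {y. (\<forall>i. y $ i \<in> base_polytope (\<lambda>U. of_int (f i U))) \<and> (\<Sum>i\<in>UNIV. y $ i) \<le> u}"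

lemma relaxation_iff:
  "y \<in> relaxation f u \<longleftrightarrow>
     (\<forall>i. (\<forall>U. load_on (y $ i) U \<le> of_int (f i U)) \<and> load_on (y $ i) UNIV = of_int (f i UNIV)) \<and>
     (\<forall>j. (\<Sum>i\<in>UNIV. y $ i $ j) \<le> u $ j)"
  by (auto simp: relaxation_def base_polytope_def less_eq_vec_def)

section \<open>Convexity and compactness of the relaxation\<close>

lemma convex_relaxation: "convex (relaxation f u)"
proof (rule convexI)
  fix x y and s t :: real
  assume xy: "x \<in> relaxation f u" "y \<in> relaxation f u" and st: "0 \<le> s" "0 \<le> t" "s + t = 1"
  have *: "s * c + t * c = c" for c by (simp add: st(3) distrib_right[symmetric])
  have "s *\<^sub>R (x $ i) + t *\<^sub>R (y $ i) \<in> base_polytope (\<lambda>U. of_int (f i U))" for i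
  proof -
    have "s *\<^sub>R (x $ i) + t *\<^sub>R (y $ i) \<in> base_polytope (\<lambda>U. s * of_int (f i U) + t * of_int (f i U))"
      by (intro base_polytope_add base_polytope_scaleR) (use xy st in \<open>auto simp: relaxation_def\<close>)
    then show ?thesis by (simp only: *)
  qed
  moreover have "(\<Sum>i\<in>UNIV. s * x $ i $ j + t * y $ i $ j) \<le> u $ j" for j
  proof -
    have "s * (\<Sum>i\<in>UNIV. x $ i $ j) + t * (\<Sum>i\<in>UNIV. y $ i $ j) \<le> s * u $ j + t * u $ j"
      using xy st by (intro add_mono mult_left_mono) (auto simp: relaxation_iff)
    then show ?thesis by (simp add: * sum.distrib sum_distrib_left)
  qed
  ultimately show "s *\<^sub>R x + t *\<^sub>R y \<in> relaxation f u"
    by (simp add: relaxation_def less_eq_vec_def)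
qed

lemma compact_relaxation:
  fixes f :: "'i::finite \<Rightarrow> 'e::finite set \<Rightarrow> int"
  shows "compact (relaxation f u)"
proof -
  have "closed {y. \<forall>i. (\<forall>U. load_on (y $ i) U \<le> of_int (f i U)) \<and>
      load_on (y $ i) UNIV = of_int (f i UNIV)}"
    unfolding load_on_def
    by (intro closed_Collect_all closed_Collect_conj closed_Collect_le closed_Collect_eq continuous_intros)
  moreover have "closed {y :: real ^ 'e ^ 'i. \<forall>j. (\<Sum>i\<in>UNIV. y $ i $ j) \<le> u $ j}"
    by (intro closed_Collect_all closed_Collect_le continuous_intros)
  moreover have "relaxation f u = {y. \<forall>i. (\<forall>U. load_on (y $ i) U \<le> of_int (f i U)) \<and>
      load_on (y $ i) UNIV = of_int (f i UNIV)} \<inter> {y. \<forall>j. (\<Sum>i\<in>UNIV. y $ i $ j) \<le> u $ j}"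
    by (auto simp: relaxation_iff)
  ultimately have "closed (relaxation f u)" by (simp only: closed_Int)
  moreover have "bounded (relaxation f u)"
  proof -
    \<comment> \<open>A number between two bounds is at most the sum of their absolute values in
      modulus.\<close>
    define b where "b i j = \<bar>real_of_int (f i UNIV - f i (UNIV - {j}))\<bar> + \<bar>of_int (f i {j})\<bar>" for i j
    have "norm y \<le> (\<Sum>i\<in>UNIV. \<Sum>j\<in>UNIV. b i j)" if "y \<in> relaxation f u" for y
    proof -
      have "\<bar>y $ i $ j\<bar> \<le> b i j" for i j
        using base_polytope_component_bounds[of "y $ i" "\<lambda>U. of_int (f i U)" j] that
        by (auto simp: relaxation_def b_def)
      then have "norm (y $ i) \<le> (\<Sum>j\<in>UNIV. b i j)" for i
        by (intro order_trans[OF norm_le_l1_cart] sum_mono)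
      then have "(\<Sum>i\<in>UNIV. norm (y $ i)) \<le> (\<Sum>i\<in>UNIV. \<Sum>j\<in>UNIV. b i j)"
        by (rule sum_mono)
      moreover have "norm y \<le> (\<Sum>i\<in>UNIV. norm (y $ i))"
        unfolding norm_vec_def[of y] by (rule L2_set_le_sum) simp
      ultimately show ?thesis by linarith
    qed
    then show ?thesis by (auto simp: bounded_iff)
  qed
  ultimately show ?thesis by (simp add: compact_eq_bounded_closed)
qed

section \<open>Extreme points and integral optima\<close>

text \<open>A direction that keeps all tight constraints allows a small move both ways, so a nonzero
  one would make \<open>y\<close> the midpoint of a feasible segment.\<close>

lemma extreme_point_relaxation_direction:
  fixes f :: "'i::finite \<Rightarrow> 'e::finite set \<Rightarrow> int" and d :: "real ^ 'e ^ 'i"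
  assumes ext: "y extreme_point_of relaxation f u"
    and base: "\<And>i U. load_on (y $ i) U = of_int (f i U) \<Longrightarrow> load_on (d $ i) U = 0"
    and cap: "\<And>j. (\<Sum>i\<in>UNIV. y $ i $ j) = u $ j \<Longrightarrow> (\<Sum>i\<in>UNIV. d $ i $ j) = 0"
  shows "d = 0"
proof (rule ccontr)
  assume "d \<noteq> 0"
  have y: "y \<in> relaxation f u" using ext by (simp add: extreme_point_of_def)
  \<comment> \<open>A tight constraint is constant along the line; a slack one stays slack near
    \<open>t = 0\<close>, on both sides.\<close>
  have line: "\<forall>\<^sub>F t in nhds (0::real). a + t * b \<le> c" if "a \<le> c" "a = c \<Longrightarrow> b = 0" for a b c :: real
  proof (cases "a = c")
    case False
    have "((\<lambda>t. a + t * b) \<longlongrightarrow> a + 0 * b) (nhds 0)"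
      by (intro tendsto_intros) (simp add: filterlim_ident)
    then have "\<forall>\<^sub>F t in nhds (0::real). a + t * b < c"
      using False that(1) by (intro order_tendstoD) auto
    then show ?thesis by (rule eventually_mono) simp
  qed (use that in auto)
  have "\<forall>\<^sub>F t in nhds 0. \<forall>i U. load_on (y $ i) U + t * load_on (d $ i) U \<le> of_int (f i U)"
    using y base by (intro eventually_all_finite line) (auto simp: relaxation_iff)
  moreover have "\<forall>\<^sub>F t in nhds 0. \<forall>j. (\<Sum>i\<in>UNIV. y $ i $ j) + t * (\<Sum>i\<in>UNIV. d $ i $ j) \<le> u $ j"
    using y cap by (intro eventually_all_finite line) (auto simp: relaxation_iff)
  \<comment> \<open>The equality for the whole set is one of the tight constraints, so
    \<open>base\<close> preserves it as well.\<close>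
  ultimately have "\<forall>\<^sub>F t in nhds 0. y + t *\<^sub>R d \<in> relaxation f u"
    by eventually_elim
      (use y base in \<open>auto simp: relaxation_iff load_on_add load_on_scaleR sum.distrib sum_distrib_left\<close>)
  then obtain e where "e > 0" and e: "\<And>t. dist t 0 < e \<Longrightarrow> y + t *\<^sub>R d \<in> relaxation f u"
    by (auto simp: eventually_nhds_metric)
  define t where "t = e / 2"
  have t: "t > 0" "y + t *\<^sub>R d \<in> relaxation f u" "y + (- t) *\<^sub>R d \<in> relaxation f u"
    using \<open>e > 0\<close> e by (auto simp: t_def simp del: scaleR_minus_left)
  have "midpoint (y + t *\<^sub>R d) (y + (- t) *\<^sub>R d) = y"
    by (simp add: midpoint_def scaleR_2[symmetric])
  moreover have "y + t *\<^sub>R d \<noteq> y + (- t) *\<^sub>R d"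
    using t(1) \<open>d \<noteq> 0\<close> by (simp add: eq_neg_iff_add_eq_0 scaleR_add_left[symmetric] del: scaleR_add_left)
  ultimately have "y \<in> open_segment (y + t *\<^sub>R d) (y + (- t) *\<^sub>R d)"
    using midpoint_in_open_segment by metis
  then show False using ext t(2,3) by (auto simp: extreme_point_of_def)
qed

text \<open>A fractional entry is never alone in its atom, whose load is integral, nor in a
  saturated column, whose total is the integer \<open>u $ j\<close>. Balanced weights on such
  entries would give a nonzero direction keeping all tight constraints.\<close>

lemma extreme_point_relaxation_integral:
  fixes f :: "'i::finite \<Rightarrow> 'e::finite set \<Rightarrow> int"
  assumes rank: "\<And>i. integral_polymatroid_rank (f i)"
    and u: "u \<in> int_vecs"
    and ext: "y extreme_point_of relaxation f u"
  shows "y $ i \<in> int_vecs"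
proof -
  have y: "y \<in> relaxation f u" using ext by (simp add: extreme_point_of_def)
  have "\<exists>D :: 'e \<Rightarrow> 'e set. (\<forall>A. load_on (y $ i) {j. D j = A} \<in> \<int>) \<and>
     (\<forall>U d. load_on (y $ i) U = of_int (f i U) \<longrightarrow> (\<forall>A. load_on d {j. D j = A} = 0) \<longrightarrow>
        load_on d U = 0)" for i
  proof -
    have "y $ i \<in> base_polytope (\<lambda>U. of_int (f i U))" using y by (simp add: relaxation_def)
    from rank this show ?thesis
    proof (rule tight_set_atoms)
      fix D :: "'e \<Rightarrow> 'e set"
      assume D: "\<And>A. load_on (y $ i) {j. D j = A} \<in> \<int>"
        "\<And>U d. load_on (y $ i) U = of_int (f i U) \<Longrightarrow> (\<And>A. load_on d {j. D j = A} = 0) \<Longrightarrow>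
          load_on d U = 0"
      have "load_on d U = 0"
        if "load_on (y $ i) U = of_int (f i U)" "\<forall>A. load_on d {j. D j = A} = 0" for U d
        by (rule D(2)) (use that in auto)
      with D(1) show ?thesis by blast
    qed
  qed
  then obtain D :: "'i \<Rightarrow> 'e \<Rightarrow> 'e set"
    where atom: "\<And>i A. load_on (y $ i) {j. D i j = A} \<in> \<int>"
      and tight: "\<And>i U d. load_on (y $ i) U = of_int (f i U) \<Longrightarrow>
            (\<And>A. load_on d {j. D i j = A} = 0) \<Longrightarrow> load_on d U = 0"
    by metis
  define S where "S = {(i, j). y $ i $ j \<notin> \<int>}"
  \<comment> \<open>Left vertices pair a player with an atom; right vertices are resources, of which
    only the saturated ones in \<open>T\<close> require balance.\<close>
  define L where "L = (\<lambda>(i, j). (i, D i j))"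
  define T where "T = {j. (\<Sum>i\<in>UNIV. y $ i $ j) = u $ j}"
  have "S = {}"
  proof (rule ccontr)
    assume ne: "S \<noteq> {}"
    have repL: "\<exists>e' \<in> S. e' \<noteq> e \<and> L e' = L e" if e: "e \<in> S" for e
    proof -
      obtain i j where ij: "e = (i, j)" by force
      then have "\<exists>k\<in>{k. D i k = D i j}. k \<noteq> j \<and> y $ i $ k \<notin> \<int>"
        using e atom[of i "D i j"]
        by (intro exists_other_non_integer) (auto simp: S_def load_on_def)
      then obtain k where "D i k = D i j" "k \<noteq> j" "y $ i $ k \<notin> \<int>" by blast
      then show ?thesis using ij by (intro bexI[of _ "(i, k)"]) (auto simp: S_def L_def)
    qed
    have repR: "\<exists>e' \<in> S. e' \<noteq> e \<and> snd e' = snd e" if e: "e \<in> S" "snd e \<in> T" for e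
    proof -
      obtain i j where ij: "e = (i, j)" by force
      then have "\<exists>k\<in>UNIV. k \<noteq> i \<and> y $ k $ j \<notin> \<int>"
        using e u by (intro exists_other_non_integer) (auto simp: S_def T_def int_vecs_def)
      then obtain k where "k \<noteq> i" "y $ k $ j \<notin> \<int>" by blast
      then show ?thesis using ij by (intro bexI[of _ "(k, j)"]) (auto simp: S_def)
    qed
    obtain d :: "'i \<times> 'e \<Rightarrow> real" where d: "d \<noteq> (\<lambda>_. 0)"
        "\<And>a. (\<Sum>e | L e = a. d e) = 0" "\<And>b. b \<in> T \<Longrightarrow> (\<Sum>e | snd e = b. d e) = 0"
      by (rule balanced_edge_weights_exist[OF ne repL repR]) blast+
    define v :: "real ^ 'e ^ 'i" where "v = (\<chi> i j. d (i, j))"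
    have "load_on (v $ i) {j. D i j = A} = (\<Sum>e | L e = (i, A). d e)" for i A
      unfolding load_on_def v_def
      by (rule sum.reindex_bij_witness[of _ snd "Pair i"]) (auto simp: L_def)
    then have atom0: "load_on (v $ i) {j. D i j = A} = 0" for i A
      using d(2) by simp
    have "(\<Sum>i\<in>UNIV. v $ i $ j) = (\<Sum>e | snd e = j. d e)" for j
      unfolding v_def
      by (rule sum.reindex_bij_witness[of _ fst "\<lambda>i. (i, j)"]) auto
    then have "v = 0"
      using tight atom0 d(3) by (intro extreme_point_relaxation_direction[OF ext]) (auto simp: T_def)
    then have "d (i, j) = 0" for i j by (simp add: v_def vec_eq_iff)
    then show False using d(1) by auto
  qed
  then show ?thesis by (auto simp: S_def int_vecs_def)
qed

text \<open>The minimizers form a nonempty compact face. An extreme point of a face is extreme in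
  the whole set, hence integral here.\<close>

lemma relaxation_integral_minimizer:
  fixes f :: "'i::finite \<Rightarrow> 'e::finite set \<Rightarrow> int" and a :: "real ^ 'e ^ 'i"
  assumes rank: "\<And>i. integral_polymatroid_rank (f i)"
    and u: "u \<in> int_vecs"
    and ne: "relaxation f u \<noteq> {}"
  obtains z where "z \<in> relaxation f u" "\<And>i. z $ i \<in> int_vecs"
    "\<And>y. y \<in> relaxation f u \<Longrightarrow> a \<bullet> z \<le> a \<bullet> y"
proof -
  have "continuous_on (relaxation f u) (\<lambda>y. a \<bullet> y)" by (intro continuous_intros)
  from continuous_attains_inf[OF compact_relaxation ne this]
  obtain m where m: "m \<in> relaxation f u" "\<And>y. y \<in> relaxation f u \<Longrightarrow> a \<bullet> m \<le> a \<bullet> y"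
    by auto
  define F where "F = relaxation f u \<inter> {y. a \<bullet> y = a \<bullet> m}"
  have face: "F face_of relaxation f u"
    unfolding F_def by (rule face_of_Int_supporting_hyperplane_ge[OF convex_relaxation]) (rule m(2))
  have "compact F" unfolding F_def by (intro compact_Int_closed compact_relaxation closed_hyperplane)
  moreover have "convex F" using face by (rule face_of_imp_convex)
  moreover have "F \<noteq> {}" using m(1) by (auto simp: F_def)
  ultimately obtain z where "z extreme_point_of F" using extreme_point_exists_convex by metis
  then have z: "z extreme_point_of relaxation f u" "z \<in> F"
    using extreme_point_of_face[OF face] by auto
  show thesis
  proof
    show "z \<in> relaxation f u" using z by (simp add: F_def)
    show "z $ i \<in> int_vecs" for i by (rule extreme_point_relaxation_integral[OF rank u z(1)])
    show "a \<bullet> z \<le> a \<bullet> y" if "y \<in> relaxation f u" for y using z m(2)[OF that] by (simp add: F_def)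
  qed
qed

section \<open>Market-clearing prices\<close>

text \<open>Duality by separation: a hyperplane keeps \<open>(0, -1)\<close>, a cost gain without
  excess load, away from the cone of attainable pairs. Its normal, scaled to cost coefficient one,
  is the price vector.\<close>

lemma market_prices_exist:
  fixes f :: "'i::finite \<Rightarrow> 'e::finite set \<Rightarrow> int" and a x :: "real ^ 'e ^ 'i"
  assumes opt: "\<And>y. y \<in> relaxation f u \<Longrightarrow> a \<bullet> x \<le> a \<bullet> y"
  obtains p where "p \<ge> 0"
    "\<And>z. (\<And>i. z $ i \<in> integral_base_set (f i)) \<Longrightarrow> a \<bullet> x \<le> a \<bullet> z + p \<bullet> ((\<Sum>i\<in>UNIV. z $ i) - u)"
proof -
  define Z where "Z = {z :: real ^ 'e ^ 'i. \<forall>i. z $ i \<in> integral_base_set (f i)}"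
  \<comment> \<open>The generators are the excess load and cost change of each integral profile; the
    axis directions will force nonnegative prices.\<close>
  define G where "G = (\<lambda>z. ((\<Sum>i\<in>UNIV. z $ i) - u, a \<bullet> z - a \<bullet> x)) ` Z \<union> range (\<lambda>j. (axis j 1, 0 :: real))"
  \<comment> \<open>A convex cone containing \<open>G\<close>: homogenized real points of the base polytopes. Optimality of
    \<open>x\<close> keeps \<open>(0, -1)\<close> out of it.\<close>
  define M where "M = {(s, t). \<exists>r\<ge>0. \<exists>y :: real ^ 'e ^ 'i.
    (\<forall>i. y $ i \<in> base_polytope (\<lambda>U. r * of_int (f i U))) \<and> (\<Sum>i\<in>UNIV. y $ i) - r *\<^sub>R u \<le> s \<and>
    t = a \<bullet> y - r * (a \<bullet> x)}"
  have MI: "(s, t) \<in> M" if "r \<ge> 0" "\<And>i. y $ i \<in> base_polytope (\<lambda>U. r * of_int (f i U))"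
      "(\<Sum>i\<in>UNIV. y $ i) - r *\<^sub>R u \<le> s" "t = a \<bullet> y - r * (a \<bullet> x)" for s t r and y :: "real ^ 'e ^ 'i"
    using that unfolding M_def by blast
  have zero: "(s, 0) \<in> M" if "s \<ge> 0" for s
    by (rule MI[of 0 0]) (use that in \<open>simp_all add: base_polytope_def load_on_def\<close>)
  have "convex_cone M"
    unfolding convex_cone_iff
  proof (intro conjI ballI allI impI)
    show "0 \<in> M" using zero[of 0] by (simp add: zero_prod_def)
  next
    fix v v' assume "v \<in> M" "v' \<in> M"
    then obtain s t r y s' t' r' y' where v: "v = (s, t)" "r \<ge> 0"
        "\<And>i. y $ i \<in> base_polytope (\<lambda>U. r * of_int (f i U))"
        "(\<Sum>i\<in>UNIV. y $ i) - r *\<^sub>R u \<le> s" "t = a \<bullet> y - r * (a \<bullet> x)"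
      and v': "v' = (s', t')" "r' \<ge> 0"
        "\<And>i. y' $ i \<in> base_polytope (\<lambda>U. r' * of_int (f i U))"
        "(\<Sum>i\<in>UNIV. y' $ i) - r' *\<^sub>R u \<le> s'" "t' = a \<bullet> y' - r' * (a \<bullet> x)"
      unfolding M_def by blast
    have "(s + s', t + t') \<in> M"
    proof (rule MI[of "r + r'" "y + y'"])
      show "(y + y') $ i \<in> base_polytope (\<lambda>U. (r + r') * of_int (f i U))" for i
        using base_polytope_add[OF v(3) v'(3)] by (simp add: distrib_right)
      show "(\<Sum>i\<in>UNIV. (y + y') $ i) - (r + r') *\<^sub>R u \<le> s + s'"
        using add_mono[OF v(4) v'(4)] by (simp add: sum.distrib algebra_simps)
    qed (use v v' in \<open>simp_all add: algebra_simps inner_add_right\<close>)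
    then show "v + v' \<in> M" using v v' by simp
  next
    fix v and c :: real assume "v \<in> M" and c: "0 \<le> c"
    then obtain s t r y where v: "v = (s, t)" "r \<ge> 0"
        "\<And>i. y $ i \<in> base_polytope (\<lambda>U. r * of_int (f i U))"
        "(\<Sum>i\<in>UNIV. y $ i) - r *\<^sub>R u \<le> s" "t = a \<bullet> y - r * (a \<bullet> x)"
      unfolding M_def by blast
    have "(c *\<^sub>R s, c * t) \<in> M"
    proof (rule MI[of "c * r" "c *\<^sub>R y"])
      show "(c *\<^sub>R y) $ i \<in> base_polytope (\<lambda>U. c * r * of_int (f i U))" for i
        using base_polytope_scaleR[OF v(3) c] by (simp add: mult.assoc)
      show "(\<Sum>i\<in>UNIV. (c *\<^sub>R y) $ i) - (c * r) *\<^sub>R u \<le> c *\<^sub>R s"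
        using scaleR_left_mono[OF v(4) c] by (simp add: scaleR_right_diff_distrib scaleR_right.sum)
    qed (use v c in \<open>simp_all add: right_diff_distrib\<close>)
    then show "c *\<^sub>R v \<in> M" using v by simp
  qed
  moreover have "G \<subseteq> M"
  proof -
    have "((\<Sum>i\<in>UNIV. z $ i) - u, a \<bullet> z - a \<bullet> x) \<in> M" if "z \<in> Z" for z
      by (rule MI[of 1 z]) (use that in \<open>auto simp: Z_def integral_base_set_eq\<close>)
    moreover have "(axis j 1, 0) \<in> M" for j
      by (rule zero) (simp add: less_eq_vec_def axis_def)
    ultimately show ?thesis by (auto simp: G_def)
  qed
  ultimately have "convex_cone hull G \<subseteq> M" by (simp add: hull_minimal)
  moreover have "(0, -1) \<notin> M"
  proof
    assume "(0, -1) \<in> M"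
    then obtain r y where r: "r \<ge> 0"
      and y: "\<And>i. y $ i \<in> base_polytope (\<lambda>U. r * of_int (f i U))"
        "(\<Sum>i\<in>UNIV. y $ i) - r *\<^sub>R u \<le> 0" "-1 = a \<bullet> y - r * (a \<bullet> x)"
      unfolding M_def by blast
    show False
    proof (cases "r = 0")
      \<comment> \<open>With \<open>r = 0\<close> the component bounds collapse, so there is no
        recession direction that could lower the cost.\<close>
      case True
      have "y $ i $ j = 0" for i j
        using base_polytope_component_bounds[OF y(1), of i j] True by auto
      then have "y = 0" by (simp add: vec_eq_iff)
      then show False using y(3) True by simp
    next
      case False
      then have pos: "r > 0" using r by simp
      \<comment> \<open>Undoing the homogenization gives a feasible point cheaper than
        \<open>x\<close> by \<open>1 / r\<close>.\<close>
      have "inverse r *\<^sub>R y \<in> relaxation f u"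
      proof -
        have "inverse r *\<^sub>R (y $ i) \<in> base_polytope (\<lambda>U. of_int (f i U))" for i
          using base_polytope_scaleR[OF y(1), of "inverse r"] pos by (simp add: mult.assoc[symmetric])
        moreover have "inverse r *\<^sub>R (\<Sum>i\<in>UNIV. y $ i) \<le> inverse r *\<^sub>R (r *\<^sub>R u)"
          by (rule scaleR_left_mono) (use y(2) pos in auto)
        ultimately show ?thesis using pos by (simp add: relaxation_def scaleR_right.sum)
      qed
      from opt[OF this] have "a \<bullet> x \<le> inverse r * (a \<bullet> y)" by simp
      then have "r * (a \<bullet> x) \<le> a \<bullet> y" using pos by (simp add: field_simps)
      then show False using y(3) by simp
    qed
  qed
  ultimately have "(0, -1) \<notin> convex_cone hull G" by blast
  \<comment> \<open>Finitely many generators make the cone closed, as strict separation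
    requires.\<close>
  moreover have "finite G"
    unfolding G_def Z_def by (simp add: finite_vec_box finite_integral_base_set)
  ultimately obtain q b where qb: "q \<bullet> (0, -1) < b" "\<And>v. v \<in> convex_cone hull G \<Longrightarrow> q \<bullet> v > b"
    using separating_hyperplane_closed_point[OF convex_convex_cone_hull closed_convex_cone_hull] by metis
  have "b < 0" using qb(2)[OF convex_cone_hull_contains_0] by simp
  \<comment> \<open>If \<open>q\<close> were negative at \<open>v\<close>, scaling \<open>v\<close>
    by \<open>b / (q \<bullet> v)\<close> would reach the value \<open>b\<close> itself within the
    cone.\<close>
  have nonneg: "q \<bullet> v \<ge> 0" if "v \<in> G" for v
  proof (rule ccontr)
    assume neg: "\<not> ?thesis"
    have "(b / (q \<bullet> v)) *\<^sub>R v \<in> convex_cone hull G"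
      using \<open>b < 0\<close> neg that by (intro convex_cone_hull_mul hull_inc) (auto simp: divide_nonpos_neg)
    from qb(2)[OF this] neg show False by simp
  qed
  obtain q1 q2 where q: "q = (q1, q2)" by force
  have q2: "q2 > 0" using qb(1) \<open>b < 0\<close> q by simp
  show thesis
  proof (rule that[of "inverse q2 *\<^sub>R q1"])
    have "q1 $ j \<ge> 0" for j
      using nonneg[of "(axis j 1, 0)"] q by (auto simp: G_def inner_axis)
    then show "0 \<le> inverse q2 *\<^sub>R q1" using q2 by (simp add: less_eq_vec_def)
  next
    fix z assume "\<And>i. z $ i \<in> integral_base_set (f i)"
    then have "((\<Sum>i\<in>UNIV. z $ i) - u, a \<bullet> z - a \<bullet> x) \<in> G" by (auto simp: G_def Z_def)
    from nonneg[OF this] q have "0 \<le> q1 \<bullet> ((\<Sum>i\<in>UNIV. z $ i) - u) + q2 * (a \<bullet> z - a \<bullet> x)"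
      by simp
    from mult_left_mono[OF this, of "inverse q2"] q2
    show "a \<bullet> x \<le> a \<bullet> z + (inverse q2 *\<^sub>R q1) \<bullet> ((\<Sum>i\<in>UNIV. z $ i) - u)"
      by (simp add: distrib_left mult.assoc[symmetric])
  qed
qed

lemma profiles_integral_base_sets_relaxation:
  assumes "x \<in> profiles (\<lambda>i. integral_base_set (f i))" "load x \<le> u"
  shows "vec_lambda x \<in> relaxation f u"
  using assms by (auto simp: profiles_def relaxation_def integral_base_set_eq load_def Pi_iff)

lemma weakly_enforceable_if_solvable:
  fixes f :: "'i::finite \<Rightarrow> 'e::finite set \<Rightarrow> int"
  assumes rank: "\<And>i. integral_polymatroid_rank (f i)"
    and u: "u \<in> int_vecs"
    and solvable: "master_problem_solvable (\<lambda>i. integral_base_set (f i)) (linear_cost w) u"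
  shows "weakly_enforceable_market_clearing (\<lambda>i. integral_base_set (f i)) (linear_cost w) u"
proof -
  let ?X = "\<lambda>i. integral_base_set (f i)"
  define a :: "real ^ 'e ^ 'i" where "a = (\<chi> i j. w i j u)"
  have cost: "(\<Sum>i\<in>UNIV. linear_cost w i u (y i)) = a \<bullet> vec_lambda y" for y
    by (simp add: linear_cost_def a_def inner_vec_def)
  from solvable obtain x where x: "load x \<le> u" "x \<in> profiles ?X"
    and x_opt: "\<And>y. load y \<le> u \<Longrightarrow> y \<in> profiles ?X \<Longrightarrow> a \<bullet> vec_lambda x \<le> a \<bullet> vec_lambda y"
    unfolding master_problem_solvable_def is_arg_min_def cost by (auto simp: not_less)
  have x_relax: "vec_lambda x \<in> relaxation f u"
    by (rule profiles_integral_base_sets_relaxation[OF x(2,1)])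
  then have ne: "relaxation f u \<noteq> {}" by blast
  obtain z where z: "z \<in> relaxation f u" "\<And>i. z $ i \<in> int_vecs"
    "\<And>y. y \<in> relaxation f u \<Longrightarrow> a \<bullet> z \<le> a \<bullet> y"
    by (rule relaxation_integral_minimizer[OF rank u ne, where a = a]) blast
  \<comment> \<open>The integral minimizer \<open>z\<close> of the relaxation competes in the master
    problem, so \<open>x\<close> is optimal for the relaxation too.\<close>
  have "a \<bullet> vec_lambda x \<le> a \<bullet> vec_lambda (vec_nth z)"
    by (rule x_opt) (use z(1,2) in \<open>auto simp: profiles_def relaxation_def integral_base_set_eq load_def\<close>)
  then have "a \<bullet> vec_lambda x \<le> a \<bullet> y" if "y \<in> relaxation f u" for y
    using z(3)[OF that] by simp
  from market_prices_exist[OF this] obtain p where p: "p \<ge> 0" and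
    p_opt: "\<And>z. (\<And>i. z $ i \<in> ?X i) \<Longrightarrow> a \<bullet> vec_lambda x \<le> a \<bullet> z + p \<bullet> ((\<Sum>i\<in>UNIV. z $ i) - u)"
    by blast
  have prod_nonneg: "0 \<le> p $ j * (u $ j - load x $ j)" for j
    using p x(1) by (auto simp: less_eq_vec_def)
  \<comment> \<open>The price inequality at \<open>x\<close> itself and feasibility bound this
    product from opposite sides; equality is complementary slackness.\<close>
  have "0 \<le> p \<bullet> (load x - u)"
    using p_opt[of "vec_lambda x"] x(2) by (simp add: profiles_def Pi_iff load_def)
  moreover have "(\<Sum>j\<in>UNIV. p $ j * (u $ j - load x $ j)) = - (p \<bullet> (load x - u))"
    by (simp add: inner_vec_def sum_negf[symmetric] right_diff_distrib)
  moreover have "0 \<le> (\<Sum>j\<in>UNIV. p $ j * (u $ j - load x $ j))"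
    by (rule sum_nonneg) (rule prod_nonneg)
  ultimately have sum0: "(\<Sum>j\<in>UNIV. p $ j * (u $ j - load x $ j)) = 0"
    and pu: "p \<bullet> u = p \<bullet> load x"
    by (simp_all add: inner_diff_right)
  have slack: "p $ j * (u $ j - load x $ j) = 0" for j
    using sum_nonneg_eq_0_iff[of UNIV "\<lambda>j. p $ j * (u $ j - load x $ j)"] prod_nonneg sum0 by simp
  have "priced_best_response ?X (linear_cost w) u p x"
    unfolding priced_best_response_def is_arg_min_def not_ex not_less
  proof (intro allI conjI notI)
    show "x i \<in> ?X i" for i using x(2) by (auto simp: profiles_def)
  next
    fix i y assume y: "y \<in> ?X i \<and> linear_cost w i u y + p \<bullet> y < linear_cost w i u (x i) + p \<bullet> x i"
    \<comment> \<open>The deviation may exceed \<open>u\<close>, yet the price inequality covers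
      every integral profile. In the separable total only the terms of player \<open>i\<close>
      differ.\<close>
    let ?y = "x(i := y)"
    have "vec_lambda ?y $ k \<in> ?X k" for k using x(2) y by (simp add: profiles_def Pi_iff)
    from p_opt[of "vec_lambda ?y", OF this]
    have "a \<bullet> vec_lambda x + p \<bullet> load x \<le> a \<bullet> vec_lambda ?y + p \<bullet> load ?y"
      by (simp add: load_def inner_diff_right pu)
    then have "(\<Sum>k\<in>UNIV. linear_cost w k u (x k) + p \<bullet> x k) \<le> (\<Sum>k\<in>UNIV. linear_cost w k u (?y k) + p \<bullet> ?y k)"
      by (simp only: cost[symmetric] load_def inner_sum_right sum.distrib)
    then show False using y by (simp add: sum.remove[of UNIV i])
  qed
  moreover have "p $ j = 0" if "load x $ j < u $ j" for j using slack[of j] that by auto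
  ultimately show ?thesis
    unfolding weakly_enforceable_market_clearing_def using x p by blast
qed

section \<open>Minimal load vectors and exact enforcement\<close>

text \<open>Otherwise \<open>load x\<close> would itself be a feasible competitor of
  \<open>u\<close>, strictly cheaper because every \<open>h j\<close> is strictly
  increasing.\<close>

lemma minimal_for_load_eq:
  assumes min: "minimal_for X u" and x: "x \<in> profiles X" "load x \<le> u"
  shows "load x = u"
proof (rule ccontr)
  assume "load x \<noteq> u"
  then obtain k where "load x $ k \<noteq> u $ k" by (auto simp: vec_eq_iff)
  then have k: "load x $ k < u $ k" and le: "\<And>j. load x $ j \<le> u $ j"
    using x(2) by (auto simp: less_eq_vec_def order_less_le)
  from min obtain h :: "'b \<Rightarrow> real \<Rightarrow> real" where h: "\<And>j. strict_mono (h j)"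
    and opt: "\<And>u'. \<exists>x\<in>profiles X. load x \<le> u' \<Longrightarrow>
      (\<Sum>j\<in>UNIV. h j (u $ j)) \<le> (\<Sum>j\<in>UNIV. h j (u' $ j))"
    unfolding minimal_for_def is_arg_min_def by (auto simp: not_less)
  have "(\<Sum>j\<in>UNIV. h j (load x $ j)) < (\<Sum>j\<in>UNIV. h j (u $ j))"
  proof (rule sum_strict_mono_ex1)
    show "\<forall>j\<in>UNIV. h j (load x $ j) \<le> h j (u $ j)"
      using h le by (simp add: strict_mono_less_eq)
    show "\<exists>j\<in>UNIV. h j (load x $ j) < h j (u $ j)"
      using h k by (auto simp: strict_mono_less)
  qed simp
  moreover have "\<exists>x'\<in>profiles X. load x' \<le> load x" using x(1) by blast
  ultimately show False using opt[of "load x"] by simp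
qed

lemma master_problem_solvable_if_finite:
  fixes X :: "'i::finite \<Rightarrow> (real ^ 'e) set"
  assumes fin: "\<And>i. finite (X i)" and ex: "x \<in> profiles X" "load x \<le> u"
  shows "master_problem_solvable X c u"
proof -
  have "profiles X = PiE UNIV X" by (auto simp: profiles_def PiE_def)
  then have "finite (profiles X)" using fin by (simp add: finite_PiE)
  then have "finite {x. load x \<le> u \<and> x \<in> profiles X}" by (rule rev_finite_subset) auto
  from ex_is_arg_min_if_finite[OF this] ex show ?thesis
    unfolding master_problem_solvable_def by auto
qed

theorem theorem4p2:
  fixes f :: "'i::finite \<Rightarrow> 'e::finite set \<Rightarrow> int"
    and X :: "'i \<Rightarrow> (real ^ 'e) set"
    and w :: "'i \<Rightarrow> 'e \<Rightarrow> real ^ 'e \<Rightarrow> real"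
    and c :: "'i \<Rightarrow> real ^ 'e \<Rightarrow> real ^ 'e \<Rightarrow> real"
  assumes "\<And>i. integral_polymatroid_rank (f i)"
    and "\<And>i. X i = integral_base_set (f i)"
    and "\<And>i u y. c i u y = linear_cost w i u y"
  shows "(\<forall>u \<in> int_vecs. master_problem_solvable X c u \<longrightarrow>
            weakly_enforceable_market_clearing X c u) \<and>
         (\<forall>u \<in> int_vecs. minimal_for X u \<longrightarrow> enforceable X c u)"
proof (intro conjI ballI impI)
  have X: "X = (\<lambda>i. integral_base_set (f i))" and c: "c = linear_cost w"
    using assms(2,3) by (simp_all add: fun_eq_iff)
  show weak: "weakly_enforceable_market_clearing X c u"
    if "u \<in> int_vecs" "master_problem_solvable X c u" for u
    using that assms(1) unfolding X c by (intro weakly_enforceable_if_solvable)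
  show "enforceable X c u" if u: "u \<in> int_vecs" and min: "minimal_for X u" for u
  proof -
    \<comment> \<open>A minimal \<open>u\<close> is feasible in its own minimization, which provides
      a profile; finiteness of the strategy sets then gives an optimum.\<close>
    obtain x where "x \<in> profiles X" "load x \<le> u"
      using min by (auto simp: minimal_for_def is_arg_min_def)
    then have "master_problem_solvable X c u"
      by (intro master_problem_solvable_if_finite) (simp_all add: X finite_integral_base_set)
    then have "weakly_enforceable_market_clearing X c u" by (rule weak[OF u])
    then show ?thesis
      unfolding weakly_enforceable_market_clearing_def enforceable_def
      using minimal_for_load_eq[OF min] by blast
  qed
qed

end
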